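(* Let $f(X)=a_0+a_1X+\cdots+a_nX^n$ be a polynomial with integer coefficients, and $a,b$ two integers such that $a^2<b^2$ and $|a_n|>\sum_{i=0}^{n-1}|a_i|\left(\frac{|a+b|}{2}\right)^{i-n}$. Then $f$ is irreducible over $\mathbb{Q}$ in each of the following cases: (i) $|f(a)|=p^kr$, $|f(b)|=p^{k+1}$ with $p$ prime and integers $k,r$ with $k\ge 0$ and $0<r<p$; (ii) $|f(a)|=p^k$, $|f(b)|=p^kr$ for some primes $p,r$ with $r<p$ and some integer $k\ge 1$. *)

theory Defs
  imports Complex_Main "HOL-Computational_Algebra.Computational_Algebra"
begin

end

theory Submission
  imports Defs
begin

text \<open>
  The dominance of the leading coefficient confines all complex roots of \<open>f\<close> to the open disc
  of radius \<open>\<bar>a + b\<bar> / 2\<close>, where every point is closer to \<open>a\<close> than to \<open>b\<close>, because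
  \<open>\<bar>a\<bar> < \<bar>b\<bar>\<close>. Hence every nonconstant factor \<open>g\<close> of \<open>f\<close> satisfies \<open>\<bar>g(a)\<bar> < \<bar>g(b)\<bar>\<close>. By
  Gauss's lemma a factorization over the rationals yields one over the integers, and two strict
  inequalities of this kind are incompatible with the prescribed factorizations of \<open>f(a)\<close> and
  \<open>f(b)\<close>.
\<close>

section \<open>Passage between integer and rational polynomials; Gauss's lemma\<close>

lemma map_poly_of_int_mult:
  "map_poly (of_int :: int \<Rightarrow> 'a::comm_ring_1) (p * q) = map_poly of_int p * map_poly of_int q"
  by (intro poly_eqI) (simp add: coeff_map_poly coeff_mult)

lemma map_poly_of_int_smult:
  "map_poly (of_int :: int \<Rightarrow> 'a::comm_ring_1) (smult k p) = smult (of_int k) (map_poly of_int p)"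
  by (intro poly_eqI) (simp add: coeff_map_poly)

lemma map_poly_of_int_eq_iff:
  "map_poly (of_int :: int \<Rightarrow> 'a::ring_char_0) p = map_poly of_int q \<longleftrightarrow> p = q"
  by (simp add: poly_eq_iff coeff_map_poly)

lemma degree_map_poly_of_int:
  "degree (map_poly (of_int :: int \<Rightarrow> 'a::ring_char_0) p) = degree p"
  by (intro degree_map_poly) simp

lemma poly_map_poly_of_int:
  "poly (map_poly (of_int :: int \<Rightarrow> 'a::comm_ring_1) p) (of_int x) = of_int (poly p x)"
  by (induction p) (simp_all add: map_poly_pCons)

lemma rat_poly_clear_denominators:
  fixes g :: "rat poly"
  obtains d :: int and G :: "int poly" where "d \<noteq> 0" "smult (of_int d) g = map_poly of_int G"
proof -
  have "\<exists>d G. d \<noteq> 0 \<and> smult (of_int d) g = map_poly of_int G"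
  proof (induction g)
    case 0
    show ?case by (intro exI[of _ 1] exI[of _ 0]) simp
  next
    case (pCons a g)
    then obtain d G where dG: "d \<noteq> 0" "smult (of_int d) g = map_poly of_int G"
      by blast
    obtain x y where xy: "quotient_of a = (x, y)"
      by force
    have y: "y > 0" and a: "a = of_int x / of_int y"
      using quotient_of_denom_pos[OF xy] quotient_of_div[OF xy] by auto
    have "smult (of_int (d * y)) (pCons a g) = map_poly of_int (pCons (d * x) (smult y G))"
      using y dG(2)
      by (simp add: map_poly_pCons map_poly_of_int_smult a mult.commute flip: dG(2))
    with dG(1) y show ?case
      by (intro exI[of _ "d * y"] exI[of _ "pCons (d * x) (smult y G)"]) simp
  qed
  with that show thesis by blast
qed

text \<open>Clearing denominators makes \<open>d * e\<close> times \<open>f\<close> an integer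
  product. Primitive parts are multiplicative and see \<open>d * e\<close> only through its sign
  \<open>u\<close>; since \<open>u * u = 1\<close>, the sign can be moved to the other side, and the
  first factor absorbs it together with the content of \<open>f\<close>.\<close>

lemma gauss_lemma_rat_factorization:
  fixes f :: "int poly" and g h :: "rat poly"
  assumes nz: "f \<noteq> 0" and fgh: "map_poly of_int f = g * h"
  obtains G H where "f = G * H" "degree G = degree g" "degree H = degree h"
proof -
  obtain d G where d: "d \<noteq> 0" "smult (of_int d) g = map_poly of_int G"
    by (rule rat_poly_clear_denominators)
  obtain e H where e: "e \<noteq> 0" "smult (of_int e) h = map_poly of_int H"
    by (rule rat_poly_clear_denominators)
  have "map_poly rat_of_int (smult (d * e) f) = map_poly of_int (G * H)"
    by (simp add: map_poly_of_int_mult map_poly_of_int_smult fgh mult.commute flip: d(2) e(2))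
  then have "smult (d * e) f = G * H"
    by (simp only: map_poly_of_int_eq_iff)
  then have "primitive_part (smult (d * e) f) = primitive_part (G * H)"
    by simp
  then have pp: "smult (unit_factor (d * e)) (primitive_part f)
      = primitive_part G * primitive_part H"
    by (simp only: primitive_part_smult primitive_part_mult)
  define u where "u = unit_factor (d * e)"
  have uu: "u * u = 1"
    using d(1) e(1) by (simp add: u_def sgn_if)
  have "primitive_part f = smult (u * u) (primitive_part f)"
    by (simp add: uu)
  also have "\<dots> = smult u (primitive_part G * primitive_part H)"
    by (simp only: pp[symmetric] u_def smult_smult)
  finally have "f = smult (content f) (smult u (primitive_part G * primitive_part H))"
    by (metis content_times_primitive_part)
  moreover have "degree (smult (content f * u) (primitive_part G)) = degree g"
  proof -
    have "u \<noteq> 0" using uu by auto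
    then show ?thesis
      using nz d degree_map_poly_of_int[of G, where 'a = rat]
      by (simp flip: d(2))
  qed
  moreover have "degree (primitive_part H) = degree h"
    using e degree_map_poly_of_int[of H, where 'a = rat] by (simp flip: e(2))
  ultimately show thesis
    using that[of "smult (content f * u) (primitive_part G)" "primitive_part H"]
    by (simp add: mult.assoc)
qed

section \<open>Location of the roots and growth of polynomials from \<open>a\<close> to
  \<open>b\<close>\<close>

text \<open>At a root with \<open>norm z\<close> at least \<open>R\<close>, the lower terms together
  would have norm strictly below that of the leading term, so they could not cancel it.\<close>

lemma norm_root_less_of_dominant:
  fixes c :: "nat \<Rightarrow> 'a::real_normed_field"
  assumes R: "R > 0"
    and dominant: "norm (c n) > (\<Sum>i<n. norm (c i) * R powi (int i - int n))"
    and root: "(\<Sum>i\<le>n. c i * z ^ i) = 0"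
  shows "norm z < R"
proof (rule ccontr)
  assume "\<not> norm z < R"
  then have Rz: "R \<le> norm z" by simp
  have le: "norm z ^ i \<le> R powi (int i - int n) * norm z ^ n" if "i < n" for i
  proof -
    \<comment> \<open>The claim is proved after multiplication by \<open>R ^ n\<close>, which keeps
      all exponents natural.\<close>
    have "R ^ n * norm z ^ i = R ^ i * norm z ^ i * R ^ (n - i)"
      using that by (simp flip: power_add)
    also have "\<dots> \<le> R ^ i * norm z ^ i * norm z ^ (n - i)"
      using R Rz by (intro mult_left_mono power_mono) auto
    also have "\<dots> = R ^ i * norm z ^ n"
      using that by (simp flip: power_add)
    finally show ?thesis
      using R by (simp add: power_int_diff field_simps)
  qed
  have "c n * z ^ n = - (\<Sum>i<n. c i * z ^ i)"
    using root by (simp add: lessThan_Suc_atMost[symmetric] eq_neg_iff_add_eq_0 add.commute)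
  then have "norm (c n) * norm z ^ n = norm (\<Sum>i<n. c i * z ^ i)"
    by (metis norm_minus_cancel norm_mult norm_power)
  also have "\<dots> \<le> (\<Sum>i<n. norm (c i) * norm z ^ i)"
    by (rule sum_norm_le) (simp add: norm_mult norm_power)
  also have "\<dots> \<le> (\<Sum>i<n. norm (c i) * (R powi (int i - int n) * norm z ^ n))"
    by (intro sum_mono mult_left_mono le) auto
  also have "\<dots> = (\<Sum>i<n. norm (c i) * R powi (int i - int n)) * norm z ^ n"
    by (simp add: sum_distrib_right mult.assoc)
  also have "\<dots> < norm (c n) * norm z ^ n"
    using dominant less_le_trans[OF R Rz] by (intro mult_strict_right_mono zero_less_power)
  finally show False by simp
qed

text \<open>Up to a constant, \<open>p\<close> is the product of its linear factors, each of which
  is smaller in norm at \<open>x\<close> than at \<open>y\<close>. The induction splits off one root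
  at a time.\<close>

lemma norm_poly_less_of_roots_closer:
  fixes p :: "complex poly"
  assumes "degree p > 0"
    and "\<And>z. poly p z = 0 \<Longrightarrow> norm (x - z) < norm (y - z)"
  shows "norm (poly p x) < norm (poly p y)"
  using assms
proof (induction "degree p" arbitrary: p rule: less_induct)
  case less
  obtain z where z: "poly p z = 0"
    using alg_closed_imp_poly_has_root less.prems(1) by blast
  then obtain q where q: "p = [:-z, 1:] * q"
    by (auto simp: poly_eq_0_iff_dvd)
  have "q \<noteq> 0" using less.prems(1) q by auto
  then have deg: "degree p = Suc (degree q)"
    unfolding q by (subst degree_mult_eq) auto
  \<comment> \<open>Only a weak inequality is available, as \<open>q\<close> may be constant;
    strictness comes from the factor of the root \<open>z\<close>.\<close>
  have le: "norm (poly q x) \<le> norm (poly q y)"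
  proof (cases "degree q = 0")
    case True
    then show ?thesis by (auto elim: degree_eq_zeroE)
  next
    case False
    then show ?thesis
      using less.hyps[of q] less.prems(2) deg by (simp add: q less_imp_le)
  qed
  \<comment> \<open>A root at \<open>y\<close> would have to be closer to \<open>x\<close> than to
    \<open>y\<close>, that is, at negative distance.\<close>
  have "poly p y \<noteq> 0"
    using less.prems(2)[of y] by auto
  then have "norm (poly q y) > 0" by (simp add: q)
  then have "norm (x - z) * norm (poly q x) < norm (y - z) * norm (poly q y)"
    using less.prems(2)[OF z] le
    by (intro le_less_trans[OF mult_left_mono mult_strict_right_mono]) auto
  then show ?case
    by (simp add: q norm_mult algebra_simps flip: norm_mult)
qed

text \<open>The squared distances differ by \<open>(b - a) * (b + a - 2 * Re z)\<close>. Since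
  \<open>2 * Re z\<close> is smaller than \<open>a + b\<close> in absolute value, the second factor
  has the sign of \<open>b + a\<close>, so the product is positive along with
  \<open>(b - a) * (b + a)\<close>.\<close>

lemma norm_diff_less_of_norm_less_midpoint:
  fixes a b :: real and z :: complex
  assumes ab: "a\<^sup>2 < b\<^sup>2" and z: "norm z < \<bar>a + b\<bar> / 2"
  shows "norm (of_real a - z) < norm (of_real b - z)"
proof -
  have pos: "(b - a) * (b + a) > 0"
    using ab by (simp add: algebra_simps power2_eq_square)
  have "\<bar>Re z\<bar> < \<bar>a + b\<bar> / 2"
    using abs_Re_le_cmod[of z] z by linarith
  then have "(b - a) * (b + a - 2 * Re z) > 0"
    using pos by (auto simp: zero_less_mult_iff)
  then have "(norm (of_real a - z))\<^sup>2 < (norm (of_real b - z))\<^sup>2"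
    unfolding cmod_power2 by (simp add: algebra_simps power2_eq_square)
  then show ?thesis
    by (rule power_less_imp_less_base) simp
qed

lemma abs_poly_less_of_roots_small:
  fixes g :: "int poly" and a b :: int
  assumes "degree g > 0" "a\<^sup>2 < b\<^sup>2"
    and "\<And>z. poly (map_poly complex_of_int g) z = 0 \<Longrightarrow> norm z < real_of_int \<bar>a + b\<bar> / 2"
  shows "\<bar>poly g a\<bar> < \<bar>poly g b\<bar>"
proof -
  have "(real_of_int a)\<^sup>2 < (real_of_int b)\<^sup>2"
    using assms(2) by (metis of_int_less_iff of_int_power)
  then have "norm (poly (map_poly complex_of_int g) (of_int a))
      < norm (poly (map_poly complex_of_int g) (of_int b))"
    using assms norm_diff_less_of_norm_less_midpoint[of "of_int a" "of_int b"]
    by (intro norm_poly_less_of_roots_closer) (simp_all add: degree_map_poly_of_int)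
  then show ?thesis
    by (simp add: poly_map_poly_of_int)
qed

section \<open>Arithmetic obstructions from prime powers\<close>

lemma abs_mult_eq_prime_powerE:
  fixes p x y :: int
  assumes "prime p" "\<bar>x * y\<bar> = p ^ k"
  obtains i j where "\<bar>x\<bar> = p ^ i" "\<bar>y\<bar> = p ^ j" "i + j = k"
proof -
  have "\<bar>x\<bar> dvd p ^ k" "\<bar>y\<bar> dvd p ^ k"
    using assms(2) by (auto simp: abs_mult simp flip: assms(2))
  then obtain i j where ij: "\<bar>x\<bar> = p ^ i" "\<bar>y\<bar> = p ^ j"
    using divides_primepow[OF assms(1)] by (metis abs_abs normalize_int_def)
  then have "p ^ (i + j) = p ^ k"
    using assms(2) by (simp add: abs_mult power_add)
  then have "i + j = k"
    using prime_gt_1_int[OF assms(1)] by (simp add: power_inject_exp)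
  with ij that show thesis by blast
qed

text \<open>Up to sign, \<open>x'\<close> and \<open>y'\<close> are \<open>p ^ i\<close> and
  \<open>p ^ j\<close> with \<open>i + j = k + 1\<close>. The smaller nonzero numbers
  \<open>x\<close> and \<open>y\<close> contain \<open>p\<close> at most \<open>i - 1\<close> and
  \<open>j - 1\<close> times, so \<open>x * y\<close> contains it at most \<open>k - 1\<close>
  times; but \<open>p ^ k * r\<close> contains it exactly \<open>k\<close> times.\<close>

lemma prime_power_jump_impossible:
  fixes p r x y x' y' :: int
  assumes p: "prime p" and r: "0 < r" "r < p"
    and xy: "\<bar>x * y\<bar> = p ^ k * r" and xy': "\<bar>x' * y'\<bar> = p ^ (k + 1)"
    and lt: "\<bar>x\<bar> < \<bar>x'\<bar>" "\<bar>y\<bar> < \<bar>y'\<bar>"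
  shows False
proof -
  obtain i j where ij: "\<bar>x'\<bar> = p ^ i" "\<bar>y'\<bar> = p ^ j" "i + j = k + 1"
    using abs_mult_eq_prime_powerE[OF p xy'] .
  have p1: "p > 1" using p by (rule prime_gt_1_int)
  have nz: "x \<noteq> 0" "y \<noteq> 0"
    using xy r p1 by auto
  have mult_lt: "multiplicity p v < l" if "v \<noteq> 0" "\<bar>v\<bar> < p ^ l" for v l
  proof -
    have "p ^ multiplicity p v \<le> \<bar>v\<bar>"
      using that(1) by (intro zdvd_imp_le) (auto simp: multiplicity_dvd)
    then have "p ^ multiplicity p v < p ^ l"
      using that(2) by linarith
    then show ?thesis
      using p1 by (simp add: power_less_imp_less_exp)
  qed
  have "\<not> p dvd r"
    using r by (simp add: zdvd_not_zless)
  then have "multiplicity p (p ^ k * r) = k"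
    using p p1 r by (intro multiplicity_eqI) auto
  moreover have "multiplicity p \<bar>x * y\<bar> = multiplicity p x + multiplicity p y"
    using p nz by (simp add: prime_elem_multiplicity_mult_distrib multiplicity_normalize_right
       flip: normalize_int_def)
  ultimately show False
    using mult_lt[OF nz(1), of i] mult_lt[OF nz(2), of j] lt ij xy by simp
qed

text \<open>Once \<open>r\<close> is cancelled from \<open>y'\<close>, only powers of
  \<open>p\<close> remain, with equal exponent sums \<open>s + t = i + j\<close>. Growth of the
  first factor means \<open>s < i\<close>, hence \<open>j < t\<close>; the cofactor
  \<open>r < p\<close> cannot make up for the lost power of \<open>p\<close>, so the second factor
  does not grow.\<close>

lemma prime_power_cofactor_jump_impossible:
  fixes p r x y x' y' :: int
  assumes p: "prime p" and r: "0 < r" "r < p"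
    and xy: "\<bar>x * y\<bar> = p ^ k" and xy': "\<bar>x' * y'\<bar> = p ^ k * r"
    and lt: "\<bar>x\<bar> < \<bar>x'\<bar>" "\<bar>y\<bar> < \<bar>y'\<bar>"
    and dvd: "r dvd y'"
  shows False
proof -
  have p1: "p > 1" using p by (rule prime_gt_1_int)
  obtain s t where st: "\<bar>x\<bar> = p ^ s" "\<bar>y\<bar> = p ^ t" "s + t = k"
    using abs_mult_eq_prime_powerE[OF p xy] .
  obtain m where m: "y' = r * m" using dvd by blast
  have "\<bar>x' * m\<bar> = p ^ k"
    using xy' r by (simp add: m abs_mult)
  then obtain i j where ij: "\<bar>x'\<bar> = p ^ i" "\<bar>m\<bar> = p ^ j" "i + j = k"
    using abs_mult_eq_prime_powerE[OF p] by metis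
  have "s < i"
    using lt(1) p1 st ij by (simp add: power_less_imp_less_exp)
  then have "j + 1 \<le> t" using st ij by simp
  have "\<bar>y'\<bar> = r * p ^ j"
    using r ij by (simp add: m abs_mult)
  also have "\<dots> \<le> p ^ (j + 1)"
    using r p1 by simp
  also have "\<dots> \<le> \<bar>y\<bar>"
    unfolding st using p1 \<open>j + 1 \<le> t\<close> by (intro power_increasing) auto
  finally show False using lt(2) by simp
qed

lemma prime_cofactor_jump_impossible:
  fixes p r x y x' y' :: int
  assumes p: "prime p" and r: "prime r" "r < p"
    and xy: "\<bar>x * y\<bar> = p ^ k" and xy': "\<bar>x' * y'\<bar> = p ^ k * r"
    and lt: "\<bar>x\<bar> < \<bar>x'\<bar>" "\<bar>y\<bar> < \<bar>y'\<bar>"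
  shows False
proof -
  have r0: "r > 0" using r(1) by (rule prime_gt_0_int)
  have "r dvd \<bar>x' * y'\<bar>" by (simp add: xy')
  \<comment> \<open>The two alternatives are symmetric under exchanging the factors.\<close>
  then have "r dvd x' \<or> r dvd y'"
    using r(1) by (simp add: prime_dvd_mult_iff)
  then show False
    using prime_power_cofactor_jump_impossible[OF p r0 r(2) xy xy' lt]
      prime_power_cofactor_jump_impossible[OF p r0 r(2), of y x k y' x'] xy xy' lt
    by (auto simp: mult.commute)
qed

section \<open>Irreducibility in the two cases\<close>

theorem corollary1p4:
  fixes c :: "nat \<Rightarrow> int" and n :: nat and f :: "int poly" and a b :: int
  assumes f: "f = (\<Sum>i\<le>n. monom (c i) i)"
    and ab: "a\<^sup>2 < b\<^sup>2"
    and dominant: "real_of_int \<bar>c n\<bar>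
           > (\<Sum>i<n. real_of_int \<bar>c i\<bar> * (real_of_int \<bar>a + b\<bar> / 2) powi (int i - int n))"
  shows "(\<forall>(p::int) (r::int) (k::nat).
            prime p \<and> 0 < r \<and> r < p \<and>
            \<bar>poly f a\<bar> = p ^ k * r \<and> \<bar>poly f b\<bar> = p ^ (k + 1)
            \<longrightarrow> irreducible (map_poly rat_of_int f))
       \<and> (\<forall>(p::int) (r::int) (k::nat).
            prime p \<and> prime r \<and> r < p \<and> k \<ge> 1 \<and>
            \<bar>poly f a\<bar> = p ^ k \<and> \<bar>poly f b\<bar> = p ^ k * r
            \<longrightarrow> irreducible (map_poly rat_of_int f))"
proof -
  define R where "R = real_of_int \<bar>a + b\<bar> / 2"
  have "a + b \<noteq> 0"
    using ab by (metis add.inverse_unique less_irrefl power2_minus)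
  then have R: "R > 0" by (simp add: R_def)
  \<comment> \<open>Strict dominance over a nonnegative sum makes \<open>c n\<close> nonzero, so the
    degree is exactly \<open>n\<close>.\<close>
  have "0 \<le> (\<Sum>i<n. real_of_int \<bar>c i\<bar> * R powi (int i - int n))"
    using R by (intro sum_nonneg) auto
  with dominant have cn: "c n \<noteq> 0"
    by (auto simp: R_def)
  have coeff_f: "coeff f i = (if i \<le> n then c i else 0)" for i
    by (simp add: f coeff_sum)
  have deg: "degree f = n"
  proof (rule antisym)
    show "degree f \<le> n" by (rule degree_le) (simp add: coeff_f)
    show "n \<le> degree f" by (rule le_degree) (simp add: coeff_f cn)
  qed
  have root: "norm z < R" if "poly (map_poly complex_of_int f) z = 0" for z
  proof (rule norm_root_less_of_dominant[OF R])
    show "(\<Sum>i<n. norm (complex_of_int (c i)) * R powi (int i - int n)) < norm (complex_of_int (c n))"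
      using dominant by (simp add: R_def)
    show "(\<Sum>i\<le>n. complex_of_int (c i) * z ^ i) = 0"
      using that by (simp add: poly_altdef degree_map_poly_of_int deg coeff_map_poly coeff_f)
  qed
  have factor_less: "\<bar>poly g a\<bar> < \<bar>poly g b\<bar>" if "g dvd f" "degree g > 0" for g
  proof (rule abs_poly_less_of_roots_small[OF that(2) ab])
    fix z assume "poly (map_poly complex_of_int g) z = 0"
    with that(1) have "poly (map_poly complex_of_int f) z = 0"
      by (auto simp: map_poly_of_int_mult)
    then show "norm z < real_of_int \<bar>a + b\<bar> / 2"
      using root by (simp add: R_def)
  qed
  \<comment> \<open>Common reduction of both cases: \<open>neq\<close> rules out constant
    \<open>f\<close>, and \<open>no\<close> is the arithmetic obstruction. If both rational factors
    had positive degree, so would the integer factors from Gauss's lemma, and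
    \<open>factor_less\<close> would apply to both; hence one factor is a nonzero constant, a
    unit.\<close>
  have irred: "irreducible (map_poly rat_of_int f)"
    if neq: "poly f a \<noteq> poly f b"
      and no: "\<And>G H. \<lbrakk>f = G * H; \<bar>poly G a\<bar> < \<bar>poly G b\<bar>; \<bar>poly H a\<bar> < \<bar>poly H b\<bar>\<rbrakk> \<Longrightarrow> False"
  proof (rule irreducibleI)
    have "degree f > 0"
      using neq degree_eq_zeroE[of f] by force
    then have "f \<noteq> 0" and nc: "degree (map_poly rat_of_int f) > 0"
      by (auto simp: degree_map_poly_of_int)
    from nc show "map_poly rat_of_int f \<noteq> 0" by auto
    with nc show "\<not> is_unit (map_poly rat_of_int f)"
      by (simp add: is_unit_iff_degree)
    fix g h assume gh: "map_poly rat_of_int f = g * h"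
    obtain G H where GH: "f = G * H" "degree G = degree g" "degree H = degree h"
      using \<open>f \<noteq> 0\<close> gh by (rule gauss_lemma_rat_factorization)
    have "g \<noteq> 0" "h \<noteq> 0"
      using \<open>map_poly rat_of_int f \<noteq> 0\<close> gh by auto
    moreover have "degree g = 0 \<or> degree h = 0"
      using no[OF GH(1)] factor_less[of G] factor_less[of H] GH by auto
    ultimately show "is_unit g \<or> is_unit h"
      by (simp add: is_unit_iff_degree)
  qed
  show ?thesis
  proof (intro conjI allI impI; elim conjE)
    fix p r :: int and k :: nat
    assume *: "prime p" "0 < r" "r < p" "\<bar>poly f a\<bar> = p ^ k * r" "\<bar>poly f b\<bar> = p ^ (k + 1)"
    show "irreducible (map_poly rat_of_int f)"
    proof (rule irred)
      \<comment> \<open>Equal values would force \<open>r = p\<close>.\<close>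
      show "poly f a \<noteq> poly f b"
        using * prime_gt_0_int[of p] by auto
      fix G H assume "f = G * H" "\<bar>poly G a\<bar> < \<bar>poly G b\<bar>" "\<bar>poly H a\<bar> < \<bar>poly H b\<bar>"
      then show False
        using * prime_power_jump_impossible[of p r "poly G a" "poly H a" k "poly G b" "poly H b"]
        by simp
    qed
  next
    fix p r :: int and k :: nat
    assume *: "prime p" "prime r" "r < p" "k \<ge> 1" "\<bar>poly f a\<bar> = p ^ k" "\<bar>poly f b\<bar> = p ^ k * r"
    show "irreducible (map_poly rat_of_int f)"
    proof (rule irred)
      \<comment> \<open>Equal values would force \<open>r = 1\<close>.\<close>
      show "poly f a \<noteq> poly f b"
        using * prime_gt_0_int[of p] prime_gt_1_int[of r] by auto
      fix G H assume "f = G * H" "\<bar>poly G a\<bar> < \<bar>poly G b\<bar>" "\<bar>poly H a\<bar> < \<bar>poly H b\<bar>"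
      then show False
        using * prime_cofactor_jump_impossible[of p r "poly G a" "poly H a" k "poly G b" "poly H b"]
        by simp
    qed
  qed
qed

end
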